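(* Let $\alpha,\beta>-1$ be real and let $\langle f,g\rangle=\int_{-1}^{1} f(x)g(x)(1-x)^{\alpha}(1+x)^{\beta}\,dx$ on real polynomials. Let $j_0^{\alpha,\beta},j_1^{\alpha,\beta},j_2^{\alpha,\beta},\dots$ be the orthogonal sequence produced by the Gram-Schmidt process (without normalization) from the sequence $1,\frac{1-x}{2},\left(\frac{1-x}{2}\right)^2,\dots$ with respect to this inner product. Then for every integer $n\ge 0$, $$j_n^{\alpha,\beta}(x)=\frac{(-1)^n\,n!}{(\alpha+\beta+n+1)_n}\,J_n^{(\alpha,\beta)}(x).$$
   Context: The Gram-Schmidt process applied to linearly independent vectors $v_0,v_1,\dots$ produces $u_k=v_k-\sum_{i=0}^{k-1}\frac{\langle v_k,u_i\rangle}{\langle u_i,u_i\rangle}u_i$ for $k\ge 0$ (so $u_0=v_0$, and the coefficient of $v_k$ in $u_k$ is $1$). The Pochhammer symbol is $(a)_n=a(a+1)\cdots(a+n-1)$, with $(a)_0=1$. The Jacobi polynomials are defined by the explicit expression $$J_n^{(\alpha,\beta)}(x)=(\alpha+1)_n\sum_{m=0}^n\frac{(-1)^m(\alpha+\beta+n+1)_m}{m!\,(n-m)!\,(\alpha+1)_m}\left(\frac{1-x}{2}\right)^m .$$ *)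

theory Defs
  imports "HOL-Analysis.Analysis" "HOL-Computational_Algebra.Polynomial"
begin

text \<open>The endpoints, where \<^term>\<open>0 powr a = 0\<close>, form a null set and do not affect the integral.
  For \<open>\<alpha>, \<beta> > -1\<close> the integrand is (absolutely) integrable for all polynomials.\<close>

definition jacobi_inner :: "real \<Rightarrow> real \<Rightarrow> real poly \<Rightarrow> real poly \<Rightarrow> real" where
  "jacobi_inner \<alpha> \<beta> f g =
     integral {-1..1} (\<lambda>x. poly f x * poly g x * (1 - x) powr \<alpha> * (1 + x) powr \<beta>)"

function gram_schmidt_poly ::
  "(real poly \<Rightarrow> real poly \<Rightarrow> real) \<Rightarrow> (nat \<Rightarrow> real poly) \<Rightarrow> nat \<Rightarrow> real poly" where
  "gram_schmidt_poly ip v k =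
     v k - (\<Sum>i<k. smult (ip (v k) (gram_schmidt_poly ip v i)
                         / ip (gram_schmidt_poly ip v i) (gram_schmidt_poly ip v i))
                     (gram_schmidt_poly ip v i))"
  by pat_completeness auto
termination
  by (relation "Wellfounded.measure (\<lambda>(ip, v, k). k)") auto

text \<open>The unfolding equation is recursive without a guard, so it would loop as a simp rule.\<close>

declare gram_schmidt_poly.simps [simp del]

text \<open>The polynomial \<^term>\<open>[:1/2, -1/2:]\<close> is \<open>(1 - x) / 2\<close>.\<close>

definition jacobi_gs :: "real \<Rightarrow> real \<Rightarrow> nat \<Rightarrow> real poly" where
  "jacobi_gs \<alpha> \<beta> = gram_schmidt_poly (jacobi_inner \<alpha> \<beta>) (\<lambda>k. [:1/2, -1/2:] ^ k)"

definition jacobi_poly :: "real \<Rightarrow> real \<Rightarrow> nat \<Rightarrow> real poly" where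
  "jacobi_poly \<alpha> \<beta> n =
     smult (pochhammer (\<alpha> + 1) n)
       (\<Sum>m=0..n. smult ((-1) ^ m * pochhammer (\<alpha> + \<beta> + real n + 1) m
                          / (fact m * fact (n - m) * pochhammer (\<alpha> + 1) m))
                   ([:1/2, -1/2:] ^ m))"

lemma poly_jacobi_poly:
  "poly (jacobi_poly \<alpha> \<beta> n) x =
     pochhammer (\<alpha> + 1) n *
       (\<Sum>m=0..n. (-1) ^ m * pochhammer (\<alpha> + \<beta> + real n + 1) m
                   / (fact m * fact (n - m) * pochhammer (\<alpha> + 1) m) * ((1 - x) / 2) ^ m)"
proof -
  have "poly [:1/2, -1/2:] x = (1 - x) / 2"
    by (simp add: field_simps)
  then show ?thesis
    by (simp only: jacobi_poly_def poly_smult poly_sum poly_power)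
qed

end

theory Submission
  imports Defs
begin

text \<open>
  Write \<open>w = (1 - x) / 2\<close>. If polynomials \<open>P\<^sub>0, P\<^sub>1, \<dots>\<close> are pairwise orthogonal with nonzero
  norms and \<open>P\<^sub>n\<close> differs from \<open>w\<^sup>n\<close> only in lower powers of \<open>w\<close>, then expanding \<open>w\<^sup>n\<close> in the
  \<open>P\<^sub>i\<close> yields precisely the Gram-Schmidt coefficients, so Gram-Schmidt returns the \<open>P\<^sub>n\<close>
  (\<open>gram_schmidt_poly_unique\<close>). Hence it suffices to see that the rescaled Jacobi polynomial
  has coefficient 1 at \<open>w\<^sup>n\<close> (\<open>jacobi_coeff_self\<close>) and is orthogonal to \<open>w\<^sup>k\<close> for \<open>k < n\<close>
  (\<open>jacobi_monic_orthogonal_power\<close>).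

  For the orthogonality, the substitution \<open>t = (1 - x) / 2\<close> turns the moments of the weight into
  Beta integrals: the moment of \<open>w\<^sup>k\<close> is a constant times \<open>(\<alpha>+1)\<^sub>k / (\<alpha>+\<beta>+2)\<^sub>k\<close>
  (\<open>has_integral_jacobi_moment\<close>). Up to a constant, the inner product with \<open>w\<^sup>k\<close> is thus the
  alternating sum over \<open>m \<le> n\<close>, with binomial weights \<open>n choose m\<close>, of the ratio
  \<open>(\<alpha>+\<beta>+n+1)\<^sub>m (\<alpha>+1)\<^sub>m\<^sub>+\<^sub>k / ((\<alpha>+1)\<^sub>m (\<alpha>+\<beta>+2)\<^sub>m\<^sub>+\<^sub>k)\<close>.
  Both quotients of Pochhammer symbols telescope, which makes this ratio a polynomial in \<open>m\<close> of
  degree \<open>n - 1\<close> (\<open>jacobi_ratio_poly\<close>), and the \<open>n\<close>-th finite difference of such a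
  polynomial is zero (\<open>alternating_binomial_sum_poly_eq_0\<close>).
\<close>

section \<open>Finite differences of polynomials\<close>

text \<open>Pascal's rule, read as: an \<open>(n+1)\<close>-st finite difference is the \<open>n\<close>-th finite difference of
  a first difference.\<close>

lemma alternating_binomial_sum_Suc:
  fixes f :: "nat \<Rightarrow> real"
  shows "(\<Sum>m\<le>Suc n. (-1) ^ m * real (Suc n choose m) * f m) =
    (\<Sum>m\<le>n. (-1) ^ m * real (n choose m) * (f m - f (Suc m)))"
proof -
  let ?c = "\<lambda>m. (-1) ^ m * real (n choose m)"
  have "(\<Sum>m\<le>Suc n. (-1) ^ m * real (Suc n choose m) * f m) =
      f 0 + (\<Sum>m\<le>n. (-1) ^ Suc m * real (Suc n choose Suc m) * f (Suc m))"
    by (subst sum.atMost_Suc_shift) simp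
  also have "(\<Sum>m\<le>n. (-1) ^ Suc m * real (Suc n choose Suc m) * f (Suc m)) =
      (\<Sum>m\<le>n. ?c (Suc m) * f (Suc m)) - (\<Sum>m\<le>n. ?c m * f (Suc m))"
    unfolding sum_subtractf [symmetric] by (intro sum.cong refl) (simp add: algebra_simps)
  also have "f 0 + ((\<Sum>m\<le>n. ?c (Suc m) * f (Suc m)) - (\<Sum>m\<le>n. ?c m * f (Suc m))) =
      (\<Sum>m\<le>Suc n. ?c m * f m) - (\<Sum>m\<le>n. ?c m * f (Suc m))"
    by (subst sum.atMost_Suc_shift) simp
  also have "(\<Sum>m\<le>Suc n. ?c m * f m) = (\<Sum>m\<le>n. ?c m * f m)"
    by simp
  finally show ?thesis
    by (simp add: sum_subtractf right_diff_distrib)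
qed

text \<open>Each first difference \<open>p(x) - p(x + 1)\<close> cancels the leading term. The bound on the degree is
  phrased through coefficients so that the case \<open>n = 0\<close>, where \<open>p = 0\<close>, can start the
  induction.\<close>

lemma alternating_binomial_sum_poly_eq_0:
  fixes p :: "real poly"
  assumes "\<And>k. k \<ge> n \<Longrightarrow> coeff p k = 0"
  shows "(\<Sum>m\<le>n. (-1) ^ m * real (n choose m) * poly p (real m)) = 0"
  using assms
proof (induction n arbitrary: p)
  case 0
  then have "p = 0"
    by (simp add: poly_eq_iff)
  then show ?case by simp
next
  case (Suc n)
  let ?s = "pcompose p [:1, 1:]"
  have deg: "degree p \<le> n"
    using Suc.prems by (intro degree_le) auto
  have degs: "degree ?s = degree p"
    by (simp add: degree_pcompose)
  have lead: "coeff ?s (degree p) = coeff p (degree p)"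
    using lead_coeff_comp[of "[:1, 1:]" p] degs by simp
  have "coeff (p - ?s) k = 0" if "k \<ge> n" for k
  proof (cases "k = degree p")
    case True
    then show ?thesis using lead by simp
  next
    case False
    then have "k > degree p" using that deg by simp
    then show ?thesis using degs by (simp add: coeff_eq_0)
  qed
  then have "(\<Sum>m\<le>n. (-1) ^ m * real (n choose m) * poly (p - ?s) (real m)) = 0"
    by (rule Suc.IH)
  then show ?case
    by (subst alternating_binomial_sum_Suc) (simp add: poly_pcompose add.commute)
qed

section \<open>Expansion of polynomials and the Gram-Schmidt process\<close>

text \<open>Used with the powers of \<open>(1 - x) / 2\<close>, to reduce integrability to the moments, and with
  the Jacobi polynomials, to expand those powers.\<close>

lemma poly_expansion:
  fixes P :: "nat \<Rightarrow> 'a::field poly"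
  assumes P: "\<And>i. i < n \<Longrightarrow> P i \<noteq> 0 \<and> degree (P i) = i"
    and q: "\<And>k. k \<ge> n \<Longrightarrow> coeff q k = 0"
  obtains a where "q = (\<Sum>i<n. smult (a i) (P i))"
  using assms
proof (induction n arbitrary: q thesis)
  case 0
  then have "q = 0"
    by (simp add: poly_eq_iff)
  then show ?case using "0.prems"(1) by simp
next
  case (Suc n)
  define c where "c = coeff q n / coeff (P n) n"
  have Pn: "degree (P n) = n" "coeff (P n) n \<noteq> 0"
    using Suc.prems(2)[of n] leading_coeff_0_iff[of "P n"] by auto
  have "coeff (q - smult c (P n)) k = 0" if "k \<ge> n" for k
  proof (cases "k = n")
    case True
    then show ?thesis using Pn by (simp add: c_def)
  next
    case False
    then show ?thesis using that Suc.prems(3)[of k] Pn by (simp add: coeff_eq_0)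
  qed
  moreover have "P i \<noteq> 0 \<and> degree (P i) = i" if "i < n" for i
    using that by (intro Suc.prems(2)) simp
  ultimately obtain a where a: "q - smult c (P n) = (\<Sum>i<n. smult (a i) (P i))"
    using Suc.IH by blast
  have "q = (\<Sum>i<n. smult (a i) (P i)) + smult c (P n)"
    using a by (simp add: algebra_simps)
  also have "\<dots> = (\<Sum>i<Suc n. smult ((a(n := c)) i) (P i))"
    by simp
  finally show ?case by (rule Suc.prems(1))
qed

text \<open>Pairing the expansion of \<open>v n\<close> with \<open>P i\<close> leaves only the \<open>i\<close>-th term, by
  orthogonality; so the coefficients of the expansion are those that the process subtracts.\<close>

lemma gram_schmidt_poly_unique:
  fixes ip :: "real poly \<Rightarrow> real poly \<Rightarrow> real"
  assumes add: "\<And>f g h. ip (f + g) h = ip f h + ip g h"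
    and smult: "\<And>c f h. ip (smult c f) h = c * ip f h"
    and orth: "\<And>i j. i \<noteq> j \<Longrightarrow> ip (P i) (P j) = 0"
    and nz: "\<And>i. ip (P i) (P i) \<noteq> 0"
    and tri: "\<And>n. \<exists>a. v n = P n + (\<Sum>i<n. smult (a i) (P i))"
  shows "gram_schmidt_poly ip v n = P n"
proof (induction n rule: less_induct)
  case (less n)
  obtain a where a: "v n = P n + (\<Sum>i<n. smult (a i) (P i))"
    using tri by blast
  have zero: "ip 0 h = 0" for h
    using smult[of 0 0 h] by simp
  have sum: "ip (\<Sum>i\<in>A. f i) h = (\<Sum>i\<in>A. ip (f i) h)" for f h and A :: "nat set"
    by (induction A rule: infinite_finite_induct) (simp_all add: zero add)
  have coef: "ip (v n) (P i) / ip (P i) (P i) = a i" if "i < n" for i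
  proof -
    have "ip (v n) (P i) = (\<Sum>j<n. a j * ip (P j) (P i))"
      using that orth[of n i] by (simp add: a add sum smult)
    also have "\<dots> = (\<Sum>j<n. if j = i then a i * ip (P i) (P i) else 0)"
      by (intro sum.cong) (auto simp: orth)
    also have "\<dots> = a i * ip (P i) (P i)"
      using that by simp
    finally show ?thesis using nz by simp
  qed
  have "gram_schmidt_poly ip v n =
      v n - (\<Sum>i<n. smult (ip (v n) (P i) / ip (P i) (P i)) (P i))"
    by (subst gram_schmidt_poly.simps) (simp add: less.IH)
  also have "\<dots> = v n - (\<Sum>i<n. smult (a i) (P i))"
    by (simp add: coef)
  finally show ?case by (simp add: a)
qed

section \<open>The moments of the Jacobi weight\<close>

definition half_one_minus :: "real poly" where
  "half_one_minus = [:1/2, -1/2:]"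

lemma degree_half_one_minus_power: "degree (half_one_minus ^ n) = n"
  by (simp add: half_one_minus_def degree_power_eq)

lemma half_one_minus_nonzero: "half_one_minus \<noteq> 0"
  by (simp add: half_one_minus_def)

definition jacobi_moment :: "real \<Rightarrow> real \<Rightarrow> nat \<Rightarrow> real" where
  "jacobi_moment \<alpha> \<beta> k = 2 powr (\<alpha> + \<beta> + 1) * Beta (\<alpha> + 1) (\<beta> + 1) *
     pochhammer (\<alpha> + 1) k / pochhammer (\<alpha> + \<beta> + 2) k"

lemma Beta_add_nat:
  fixes a b :: real
  assumes "a > 0" "b > 0"
  shows "Beta (a + real k) b = Beta a b * pochhammer a k / pochhammer (a + b) k"
proof (induction k)
  case (Suc k)
  have "(a + real k + b) * Beta (a + real k + 1) b = (a + real k) * Beta (a + real k) b"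
    using assms by (intro Beta_plus1_left) (auto elim!: nonpos_Ints_cases)
  moreover have "a + real k + b > 0" "pochhammer (a + b) k > 0"
    using assms by (auto intro!: pochhammer_pos)
  ultimately have "Beta (a + real k + 1) b =
      (a + real k) * (Beta a b * pochhammer a k / pochhammer (a + b) k) / (a + real k + b)"
    using Suc.IH by (simp add: nonzero_eq_divide_eq mult_ac)
  then show ?case
    by (simp add: pochhammer_Suc add_ac mult_ac)
qed simp

text \<open>Substituting \<open>t = (1 - x) / 2\<close> gives \<open>1 - x = 2 t\<close> and \<open>1 + x = 2 (1 - t)\<close>; the powers
  of 2 collect to \<open>2 powr (\<alpha> + \<beta>)\<close>, and one more factor 2 comes from \<open>dx\<close>.\<close>

lemma has_integral_jacobi_moment:
  fixes \<alpha> \<beta> :: real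
  assumes "\<alpha> > -1" "\<beta> > -1"
  shows "((\<lambda>x. poly (half_one_minus ^ k) x * (1 - x) powr \<alpha> * (1 + x) powr \<beta>)
    has_integral jacobi_moment \<alpha> \<beta> k) {-1..1}"
proof -
  let ?f = "\<lambda>t::real. t powr (\<alpha> + real k) * (1 - t) powr \<beta>"
  have eq: "2 powr (\<alpha> + \<beta>) * ?f (- (1/2) * x + 1/2) =
      poly (half_one_minus ^ k) x * (1 - x) powr \<alpha> * (1 + x) powr \<beta>" if "x \<in> {-1..1}" for x
  proof -
    define t u where "t = (1 - x) / 2" and "u = (1 + x) / 2"
    have t: "t \<ge> 0" "u \<ge> 0" "1 - x = 2 * t" "1 + x = 2 * u" "- (1/2) * x + 1/2 = t"
        "poly half_one_minus x = t" "1 - t = u"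
      using that by (auto simp: t_def u_def half_one_minus_def field_simps)
    \<comment> \<open>At \<open>t = 0\<close> both sides vanish because \<open>0 powr a = 0\<close>, even for negative \<open>a\<close>.\<close>
    have "t powr (\<alpha> + real k) = t powr \<alpha> * t ^ k"
      using t(1) by (cases "t = 0") (auto simp: powr_add powr_realpow)
    then show ?thesis
      using t(1,2) unfolding t(3-5) poly_power t(6,7) by (simp add: powr_mult powr_add[of 2])
  qed
  have "(?f has_integral Beta (\<alpha> + 1 + real k) (\<beta> + 1)) (cbox 0 1)"
    using has_integral_Beta_real[of "\<alpha> + 1 + real k" "\<beta> + 1"] assms by (simp add: add_ac)
  from has_integral_affinity[OF this, of "- (1/2)" "1/2"]
  have "((\<lambda>x. ?f (- (1/2) * x + 1/2)) has_integral 2 * Beta (\<alpha> + 1 + real k) (\<beta> + 1))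
      ((\<lambda>x. - 2 * x + 1) ` {0..1})"
    by simp
  also have "(\<lambda>x::real. - 2 * x + 1) ` {0..1} = {-1..1}"
    using image_affinity_atLeastAtMost[of "-2::real" 1 0 1] by simp
  finally have "((\<lambda>x. 2 powr (\<alpha> + \<beta>) * ?f (- (1/2) * x + 1/2)) has_integral
      2 powr (\<alpha> + \<beta>) * (2 * Beta (\<alpha> + 1 + real k) (\<beta> + 1))) {-1..1}"
    by (rule has_integral_mult_right)
  then have "((\<lambda>x. poly (half_one_minus ^ k) x * (1 - x) powr \<alpha> * (1 + x) powr \<beta>) has_integral
      2 powr (\<alpha> + \<beta>) * (2 * Beta (\<alpha> + 1 + real k) (\<beta> + 1))) {-1..1}"
    by (rule has_integral_eq[rotated]) (use eq in blast)
  also have "2 powr (\<alpha> + \<beta>) * (2 * Beta (\<alpha> + 1 + real k) (\<beta> + 1)) = jacobi_moment \<alpha> \<beta> k"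
  proof -
    have "Beta (\<alpha> + 1 + real k) (\<beta> + 1) = Beta (\<alpha> + 1) (\<beta> + 1) *
        pochhammer (\<alpha> + 1) k / pochhammer (\<alpha> + \<beta> + 2) k"
      using Beta_add_nat[of "\<alpha> + 1" "\<beta> + 1" k] assms by (simp add: algebra_simps)
    then show ?thesis
      by (simp add: jacobi_moment_def powr_add)
  qed
  finally show ?thesis .
qed

lemma jacobi_weight_integrable:
  fixes \<alpha> \<beta> :: real
  assumes "\<alpha> > -1" "\<beta> > -1"
  shows "(\<lambda>x. poly p x * (1 - x) powr \<alpha> * (1 + x) powr \<beta>) integrable_on {-1..1}"
proof -
  let ?n = "Suc (degree p)"
  obtain a where a: "p = (\<Sum>i<?n. smult (a i) (half_one_minus ^ i))"
    by (rule poly_expansion[of ?n "\<lambda>i. half_one_minus ^ i" p])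
      (auto simp: degree_half_one_minus_power half_one_minus_nonzero coeff_eq_0)
  have "(\<lambda>x. \<Sum>i<?n. a i * (poly (half_one_minus ^ i) x * (1 - x) powr \<alpha> * (1 + x) powr \<beta>))
      integrable_on {-1..1}"
    using has_integral_jacobi_moment[OF assms]
    by (intro integrable_sum integrable_on_mult_right) blast+
  also have "(\<lambda>x. \<Sum>i<?n. a i * (poly (half_one_minus ^ i) x * (1 - x) powr \<alpha> * (1 + x) powr \<beta>)) =
      (\<lambda>x. poly p x * (1 - x) powr \<alpha> * (1 + x) powr \<beta>)"
    by (subst (2) a) (simp only: poly_sum poly_smult sum_distrib_right mult.assoc)
  finally show ?thesis .
qed

section \<open>The Jacobi inner product\<close>

lemma jacobi_inner_commute: "jacobi_inner \<alpha> \<beta> f g = jacobi_inner \<alpha> \<beta> g f"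
  by (simp add: jacobi_inner_def mult_ac)

lemma jacobi_inner_smult_left:
  "jacobi_inner \<alpha> \<beta> (smult c f) g = c * jacobi_inner \<alpha> \<beta> f g"
  unfolding jacobi_inner_def by (subst integral_mult_right [symmetric]) (simp add: mult_ac)

lemma jacobi_inner_add_left:
  assumes "\<alpha> > -1" "\<beta> > -1"
  shows "jacobi_inner \<alpha> \<beta> (f + g) h = jacobi_inner \<alpha> \<beta> f h + jacobi_inner \<alpha> \<beta> g h"
proof -
  have int: "(\<lambda>x. poly f x * poly h x * (1 - x) powr \<alpha> * (1 + x) powr \<beta>) integrable_on {-1..1}" for f
    using jacobi_weight_integrable[OF assms, of "f * h"] by simp
  show ?thesis
    unfolding jacobi_inner_def
    by (subst integral_add [OF int int, symmetric]) (simp add: algebra_simps)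
qed

lemma jacobi_inner_sum_left:
  assumes "\<alpha> > -1" "\<beta> > -1"
  shows "jacobi_inner \<alpha> \<beta> (\<Sum>i\<in>A. f i) h = (\<Sum>i\<in>A. jacobi_inner \<alpha> \<beta> (f i) h)"
proof -
  have "jacobi_inner \<alpha> \<beta> 0 h = 0"
    by (simp add: jacobi_inner_def)
  then show ?thesis
    by (induction A rule: infinite_finite_induct) (simp_all add: jacobi_inner_add_left[OF assms])
qed

lemma jacobi_inner_half_one_minus_power:
  assumes "\<alpha> > -1" "\<beta> > -1"
  shows "jacobi_inner \<alpha> \<beta> (half_one_minus ^ i) (half_one_minus ^ j) = jacobi_moment \<alpha> \<beta> (i + j)"
proof -
  have "jacobi_inner \<alpha> \<beta> (half_one_minus ^ i) (half_one_minus ^ j) =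
      integral {-1..1} (\<lambda>x. poly (half_one_minus ^ (i + j)) x * (1 - x) powr \<alpha> * (1 + x) powr \<beta>)"
    by (simp only: jacobi_inner_def power_add poly_mult)
  then show ?thesis
    using has_integral_jacobi_moment[OF assms] by (simp only: integral_unique)
qed

text \<open>The weight may be unbounded at the endpoints, so positivity is tested on the smaller interval
  \<open>[-1/2, 1/2]\<close>, where it is continuous and positive: a vanishing norm would give \<open>p\<close>
  infinitely many roots.\<close>

lemma jacobi_inner_self_nonzero:
  assumes "\<alpha> > -1" "\<beta> > -1" and "p \<noteq> 0"
  shows "jacobi_inner \<alpha> \<beta> p p \<noteq> 0"
proof
  assume zero: "jacobi_inner \<alpha> \<beta> p p = 0"
  let ?f = "\<lambda>x. poly p x * poly p x * (1 - x) powr \<alpha> * (1 + x) powr \<beta>"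
  let ?I = "{-(1/2)..1/2::real}"
  have cont: "continuous_on ?I ?f"
    by (intro continuous_intros) auto
  have nonneg: "?f x \<ge> 0" for x
    by simp
  have int: "?f integrable_on {-1..1}"
    using jacobi_weight_integrable[OF assms(1,2), of "p * p"] by simp
  have "integral ?I ?f \<le> integral {-1..1} ?f"
    using int nonneg integrable_continuous_interval[OF cont]
    by (intro integral_subset_le) auto
  moreover have "integral ?I ?f \<ge> 0"
    using cont by (intro integral_nonneg integrable_continuous_interval) auto
  ultimately have "integral ?I ?f = 0"
    using zero by (simp add: jacobi_inner_def)
  then have f0: "\<forall>x\<in>?I. ?f x = 0"
    using integral_eq_0_iff[of "-(1/2)" "1/2" ?f] cont nonneg by simp
  have "?I \<subseteq> {x. poly p x = 0}"
  proof
    fix x assume x: "x \<in> ?I"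
    then have "?f x = 0" using f0 by blast
    then show "x \<in> {x. poly p x = 0}" using x by simp
  qed
  moreover have "infinite ?I"
    by simp
  ultimately show False
    using poly_roots_finite[OF \<open>p \<noteq> 0\<close>] finite_subset by blast
qed

section \<open>The monic Jacobi polynomials\<close>

definition jacobi_coeff :: "real \<Rightarrow> real \<Rightarrow> nat \<Rightarrow> nat \<Rightarrow> real" where
  "jacobi_coeff \<alpha> \<beta> n m =
     (-1) ^ n * pochhammer (\<alpha> + 1) n / pochhammer (\<alpha> + \<beta> + real n + 1) n *
     ((-1) ^ m * real (n choose m) * pochhammer (\<alpha> + \<beta> + real n + 1) m / pochhammer (\<alpha> + 1) m)"

text \<open>Monic with respect to \<open>(1 - x) / 2\<close>, not to \<open>x\<close>.\<close>

definition jacobi_monic :: "real \<Rightarrow> real \<Rightarrow> nat \<Rightarrow> real poly" where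
  "jacobi_monic \<alpha> \<beta> n =
     smult ((-1) ^ n * fact n / pochhammer (\<alpha> + \<beta> + real n + 1) n) (jacobi_poly \<alpha> \<beta> n)"

text \<open>The factor \<open>n!\<close> of the normalization combines with \<open>m! (n - m)!\<close> to the binomial
  coefficient of the finite difference.\<close>

lemma jacobi_monic_expansion:
  "jacobi_monic \<alpha> \<beta> n = (\<Sum>m\<le>n. smult (jacobi_coeff \<alpha> \<beta> n m) (half_one_minus ^ m))"
proof -
  have "jacobi_monic \<alpha> \<beta> n = (\<Sum>m\<le>n. smult
      ((-1) ^ n * fact n / pochhammer (\<alpha> + \<beta> + real n + 1) n * pochhammer (\<alpha> + 1) n *
        ((-1) ^ m * pochhammer (\<alpha> + \<beta> + real n + 1) m
          / (fact m * fact (n - m) * pochhammer (\<alpha> + 1) m))) (half_one_minus ^ m))"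
    unfolding jacobi_monic_def jacobi_poly_def half_one_minus_def [symmetric]
    by (simp add: poly_eq_iff coeff_sum sum_distrib_left atMost_atLeast0 mult_ac)
  also have "\<dots> = (\<Sum>m\<le>n. smult (jacobi_coeff \<alpha> \<beta> n m) (half_one_minus ^ m))"
    by (intro sum.cong refl arg_cong2[where f = smult])
      (simp add: jacobi_coeff_def binomial_fact)
  finally show ?thesis .
qed

text \<open>For \<open>n = 0\<close> the base \<open>\<alpha> + \<beta> + n + 1\<close> may be negative, but then the product is empty.\<close>

lemma pochhammer_jacobi_pos:
  fixes \<alpha> \<beta> :: real
  assumes "\<alpha> > -1" "\<beta> > -1"
  shows "pochhammer (\<alpha> + \<beta> + real n + 1) n > 0"
  using assms by (cases n) (auto intro!: pochhammer_pos)

lemma jacobi_coeff_self: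
  assumes "\<alpha> > -1" "\<beta> > -1"
  shows "jacobi_coeff \<alpha> \<beta> n n = 1"
proof -
  have "pochhammer (\<alpha> + 1) n > 0"
    using assms by (intro pochhammer_pos) simp
  then show ?thesis
    using pochhammer_jacobi_pos[OF assms, of n]
    by (simp add: jacobi_coeff_def power_mult_distrib [symmetric])
qed

lemma jacobi_monic_coeff:
  assumes "\<alpha> > -1" "\<beta> > -1" "k \<ge> n"
  shows "coeff (jacobi_monic \<alpha> \<beta> n) k = coeff (half_one_minus ^ n) k"
proof -
  have "jacobi_monic \<alpha> \<beta> n =
      (\<Sum>m<n. smult (jacobi_coeff \<alpha> \<beta> n m) (half_one_minus ^ m)) + half_one_minus ^ n"
    by (simp add: jacobi_monic_expansion lessThan_Suc_atMost [symmetric] jacobi_coeff_self assms)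
  moreover have "coeff (half_one_minus ^ m) k = 0" if "m < n" for m
    using that assms(3) by (intro coeff_eq_0) (simp add: degree_half_one_minus_power)
  ultimately show ?thesis
    by (simp add: coeff_sum)
qed

lemma jacobi_monic_degree:
  assumes "\<alpha> > -1" "\<beta> > -1"
  shows "jacobi_monic \<alpha> \<beta> n \<noteq> 0 \<and> degree (jacobi_monic \<alpha> \<beta> n) = n"
proof -
  have "coeff (half_one_minus ^ n) n \<noteq> 0"
    using leading_coeff_0_iff[of "half_one_minus ^ n"]
    by (simp add: degree_half_one_minus_power half_one_minus_nonzero)
  then have nz: "coeff (jacobi_monic \<alpha> \<beta> n) n \<noteq> 0"
    using jacobi_monic_coeff[OF assms, of n n] by simp
  have "coeff (jacobi_monic \<alpha> \<beta> n) k = 0" if "k > n" for k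
    using that jacobi_monic_coeff[OF assms, of n k]
    by (simp add: coeff_eq_0 degree_half_one_minus_power)
  then have "degree (jacobi_monic \<alpha> \<beta> n) \<le> n"
    by (intro degree_le) auto
  then show ?thesis
    using nz le_degree[OF nz] by auto
qed

text \<open>With \<open>s = \<alpha> + \<beta> + 2\<close> one has \<open>(\<alpha>+1)\<^sub>m\<^sub>+\<^sub>k / (\<alpha>+1)\<^sub>m = (\<alpha>+1+m)\<^sub>k\<close>. Moreover the base
  \<open>\<alpha> + \<beta> + n + 1\<close> equals \<open>s + (n - 1)\<close>, so that the other quotient is
  \<open>(s+m+k)\<^sub>n\<^sub>-\<^sub>1\<^sub>-\<^sub>k / (s)\<^sub>n\<^sub>-\<^sub>1\<close>; the hypothesis \<open>k < n\<close> makes the length \<open>n - 1 - k\<close> legitimate.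
  The degrees in \<open>m\<close> add up to \<open>n - 1\<close>.\<close>

lemma jacobi_ratio_poly:
  fixes \<alpha> \<beta> :: real
  assumes "\<alpha> > -1" "\<beta> > -1" "k < n"
  obtains c p where "\<And>j. j \<ge> n \<Longrightarrow> coeff p j = 0"
    and "\<And>m. pochhammer (\<alpha> + \<beta> + real n + 1) m / pochhammer (\<alpha> + 1) m *
        (pochhammer (\<alpha> + 1) (m + k) / pochhammer (\<alpha> + \<beta> + 2) (m + k)) = c * poly p (real m)"
proof -
  define s where "s = \<alpha> + \<beta> + 2"
  have s: "s > 0" "\<alpha> + 1 > 0" using assms by (simp_all add: s_def)
  define p where "p = (\<Prod>i<k. [:\<alpha> + 1 + real i, 1:]) * (\<Prod>i<n - 1 - k. [:s + real k + real i, 1:])"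
  have "degree p \<le> (\<Sum>i<k. 1) + (\<Sum>i<n - 1 - k. 1)"
    unfolding p_def
    by (intro order.trans[OF degree_mult_le] add_mono order.trans[OF degree_prod_sum_le] sum_mono) auto
  then have "coeff p j = 0" if "j \<ge> n" for j
    using that assms(3) by (intro coeff_eq_0) simp
  moreover have "pochhammer (\<alpha> + \<beta> + real n + 1) m / pochhammer (\<alpha> + 1) m *
        (pochhammer (\<alpha> + 1) (m + k) / pochhammer (\<alpha> + \<beta> + 2) (m + k)) =
        1 / pochhammer s (n - 1) * poly p (real m)" for m
  proof -
    have pos: "pochhammer s i > 0" "pochhammer (\<alpha> + 1) i > 0" for i
      using s by (auto intro!: pochhammer_pos)
    have p: "poly p (real m) =
        pochhammer (\<alpha> + 1 + real m) k * pochhammer (s + real (m + k)) (n - 1 - k)"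
      by (simp add: p_def poly_prod pochhammer_prod atLeast0LessThan add_ac)
    \<comment> \<open>Split the product \<open>(s)\<^sub>n\<^sub>-\<^sub>1\<^sub>+\<^sub>m\<close> after \<open>n - 1\<close> and after \<open>m + k\<close> factors.\<close>
    have "pochhammer s (n - 1) * pochhammer (s + real (n - 1)) m = pochhammer s (n - 1 + m)"
      by (simp add: pochhammer_product')
    also have "n - 1 + m = (m + k) + (n - 1 - k)"
      using assms(3) by simp
    also have "pochhammer s \<dots> = pochhammer s (m + k) * pochhammer (s + real (m + k)) (n - 1 - k)"
      by (rule pochhammer_product')
    also have "s + real (n - 1) = \<alpha> + \<beta> + real n + 1"
      using assms(3) by (simp add: s_def of_nat_diff)
    finally have 1: "pochhammer (\<alpha> + \<beta> + real n + 1) m / pochhammer s (m + k) =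
        pochhammer (s + real (m + k)) (n - 1 - k) / pochhammer s (n - 1)"
      using pos(1)[of "n - 1"] pos(1)[of "m + k"] by (simp add: field_simps)
    have 2: "pochhammer (\<alpha> + 1) (m + k) / pochhammer (\<alpha> + 1) m = pochhammer (\<alpha> + 1 + real m) k"
      using pos(2)[of m] by (simp add: pochhammer_product')
    have "pochhammer (\<alpha> + \<beta> + real n + 1) m / pochhammer (\<alpha> + 1) m *
        (pochhammer (\<alpha> + 1) (m + k) / pochhammer s (m + k)) =
        (pochhammer (\<alpha> + \<beta> + real n + 1) m / pochhammer s (m + k)) *
        (pochhammer (\<alpha> + 1) (m + k) / pochhammer (\<alpha> + 1) m)"
      by simp
    also have "\<dots> = 1 / pochhammer s (n - 1) * poly p (real m)"
      unfolding 1 2 p by simp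
    finally show ?thesis unfolding s_def .
  qed
  ultimately show ?thesis by (rule that)
qed

lemma jacobi_monic_orthogonal_power:
  assumes "\<alpha> > -1" "\<beta> > -1" "k < n"
  shows "jacobi_inner \<alpha> \<beta> (jacobi_monic \<alpha> \<beta> n) (half_one_minus ^ k) = 0"
proof -
  obtain c p where deg: "\<And>j. j \<ge> n \<Longrightarrow> coeff p j = 0"
    and p: "\<And>m. pochhammer (\<alpha> + \<beta> + real n + 1) m / pochhammer (\<alpha> + 1) m *
        (pochhammer (\<alpha> + 1) (m + k) / pochhammer (\<alpha> + \<beta> + 2) (m + k)) = c * poly p (real m)"
    using jacobi_ratio_poly[OF assms] by metis
  define C where "C = (-1) ^ n * pochhammer (\<alpha> + 1) n / pochhammer (\<alpha> + \<beta> + real n + 1) n *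
    (2 powr (\<alpha> + \<beta> + 1) * Beta (\<alpha> + 1) (\<beta> + 1))"
  have summand: "jacobi_coeff \<alpha> \<beta> n m * jacobi_moment \<alpha> \<beta> (m + k) =
      C * c * ((-1) ^ m * real (n choose m) * poly p (real m))" for m
  proof -
    have "jacobi_coeff \<alpha> \<beta> n m * jacobi_moment \<alpha> \<beta> (m + k) =
      C * ((-1) ^ m * real (n choose m)) *
      (pochhammer (\<alpha> + \<beta> + real n + 1) m / pochhammer (\<alpha> + 1) m *
        (pochhammer (\<alpha> + 1) (m + k) / pochhammer (\<alpha> + \<beta> + 2) (m + k)))"
      unfolding jacobi_coeff_def jacobi_moment_def C_def
      by (simp only: times_divide_times_eq times_divide_eq_left times_divide_eq_right
          divide_divide_eq_left mult_ac)
    then show ?thesis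
      unfolding p by (simp only: mult_ac)
  qed
  have "jacobi_inner \<alpha> \<beta> (jacobi_monic \<alpha> \<beta> n) (half_one_minus ^ k) =
      (\<Sum>m\<le>n. jacobi_coeff \<alpha> \<beta> n m * jacobi_moment \<alpha> \<beta> (m + k))"
    unfolding jacobi_monic_expansion jacobi_inner_sum_left[OF assms(1,2)] jacobi_inner_smult_left
      jacobi_inner_half_one_minus_power[OF assms(1,2)] ..
  also have "\<dots> = C * c * (\<Sum>m\<le>n. (-1) ^ m * real (n choose m) * poly p (real m))"
    by (simp only: summand sum_distrib_left)
  also have "\<dots> = 0"
    using alternating_binomial_sum_poly_eq_0[OF deg] by simp
  finally show ?thesis .
qed

lemma jacobi_monic_orthogonal:
  assumes "\<alpha> > -1" "\<beta> > -1" "i < n"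
  shows "jacobi_inner \<alpha> \<beta> (jacobi_monic \<alpha> \<beta> i) (jacobi_monic \<alpha> \<beta> n) = 0"
proof -
  have "jacobi_inner \<alpha> \<beta> (half_one_minus ^ m) (jacobi_monic \<alpha> \<beta> n) = 0" if "m \<le> i" for m
    using jacobi_monic_orthogonal_power[OF assms(1,2), of m n] that assms(3)
    by (subst jacobi_inner_commute) simp
  then show ?thesis
    unfolding jacobi_monic_expansion[of _ _ i] jacobi_inner_sum_left[OF assms(1,2)]
      jacobi_inner_smult_left by simp
qed

theorem mainTheorem2:
  fixes \<alpha> \<beta> :: real and n :: nat
  assumes "\<alpha> > -1" and "\<beta> > -1"
  shows "jacobi_gs \<alpha> \<beta> n =
    smult ((-1) ^ n * fact n / pochhammer (\<alpha> + \<beta> + real n + 1) n) (jacobi_poly \<alpha> \<beta> n)"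
proof -
  let ?P = "jacobi_monic \<alpha> \<beta>"
  note deg = jacobi_monic_degree[OF assms]
  have tri: "\<exists>a. half_one_minus ^ m = ?P m + (\<Sum>i<m. smult (a i) (?P i))" for m
  proof -
    obtain a where "half_one_minus ^ m - ?P m = (\<Sum>i<m. smult (a i) (?P i))"
      by (rule poly_expansion[of m ?P "half_one_minus ^ m - ?P m"])
        (simp_all add: deg jacobi_monic_coeff[OF assms])
    then have "half_one_minus ^ m = ?P m + (\<Sum>i<m. smult (a i) (?P i))"
      by (simp add: algebra_simps)
    then show ?thesis by blast
  qed
  have orth: "jacobi_inner \<alpha> \<beta> (?P i) (?P j) = 0" if "i \<noteq> j" for i j
    using that jacobi_monic_orthogonal[OF assms] jacobi_inner_commute
    by (metis nat_neq_iff)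
  have "gram_schmidt_poly (jacobi_inner \<alpha> \<beta>) (\<lambda>k. half_one_minus ^ k) n = ?P n"
    by (rule gram_schmidt_poly_unique)
      (simp_all add: jacobi_inner_add_left[OF assms] jacobi_inner_smult_left orth tri
        jacobi_inner_self_nonzero[OF assms] deg)
  then show ?thesis
    by (simp only: jacobi_gs_def jacobi_monic_def half_one_minus_def)
qed

end
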